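(* There is a nonempty Zariski-open, conjugation-invariant set $\Omega\subset \mathrm{GL}(3,\mathbb{C})\times \mathrm{GL}(3,\mathbb{C})$ of pairs in general position such that the following hold. (a) For $(A,B)\in\Omega$ and every ordering $(h_1,h_2,h_3)$ of the eigenvalues of $A$, the distinguished point $(L:M:1)\in\mathbb{CP}^2$ is well defined and is uniquely determined by the class of $(A,B)$ in $\mathfrak{M}(3)$ and the ordering $(h_1,h_2,h_3)$. That is, it does not depend on the choice of representative in the conjugacy class nor on the choice of eigenbasis of $A$ (with eigenvectors listed in the order $h_1,h_2,h_3$). (b) A pair $(A,B)\in\Omega$ can be reconstructed, as an element of $\mathfrak{M}(3)$, from its spectral curve $\mathfrak{C}$ (with the fixed ordering of its points $(h_j:-1:0)$ on the line $\nu=0$) and the distinguished point $(L:M:1)$. That is, if $(A,B),(A',B')\in\Omega$ have the same spectral curve equation $\det(\lambda+\mu A+\nu B)=\det(\lambda+\mu A'+\nu B')$, the eigenvalues of $A$ and $A'$ are ordered in the same way $(h_1,h_2,h_3)=(h_1',h_2',h_3')$, and $(L:M:1)=(L':M':1)$, then there is $g\in \mathrm{GL}(3,\mathbb{C})$ with $A'=gAg^{-1}$ and $B'=gBg^{-1}$.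
   Context: $\mathfrak{M}(3)$ is the set of pairs $(A,B)$ of invertible complex $3\times3$ matrices modulo simultaneous conjugation $(A,B)\sim(gAg^{-1},gBg^{-1})$. The spectral curve of $(A,B)$ is the plane cubic $\mathfrak{C}=\{(\lambda:\mu:\nu)\in\mathbb{CP}^2:\det(\lambda+\mu A+\nu B)=0\}$, where $\lambda$ stands for $\lambda\cdot 1$. Distinguished point. Let $A$ have distinct eigenvalues, listed in a fixed order $h_1,h_2,h_3$. In a basis of eigenvectors of $A$ (in this order) we have $A=\mathrm{diag}(h_1,h_2,h_3)$, and $B$ has a matrix $U=(u_{ij})$, defined up to conjugation by a diagonal matrix. Assume $u_{12}u_{13}\neq0$. Put $$L=\frac{u_{12}h_3(u_{12}u_{23}-u_{13}u_{22})+u_{13}h_2(u_{12}u_{33}-u_{13}u_{32})}{u_{12}u_{13}(h_3-h_2)},$$ $$M=-\frac{u_{12}(u_{12}u_{23}-u_{13}u_{22})+u_{13}(u_{12}u_{33}-u_{13}u_{32})}{u_{12}u_{13}(h_3-h_2)}.$$ The distinguished point is $(L:M:1)$. It is the unique point with $\nu=1$ for which $\ker(\lambda+\mu A+\nu B)$ contains a nonzero vector whose first coordinate in the eigenbasis is $0$; it lies on $\mathfrak{C}$. *)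

theory Defs
  imports "HOL-Analysis.Analysis"
begin

type_synonym mat3 = "complex^3^3"

definition GL3 :: "mat3 set" where
  "GL3 = {A. invertible A}"

text \<open>Two pairs represent the same point of the moduli space of pairs of invertible matrices
  iff they are related by \<open>sim_conj\<close>.\<close>

definition sim_conj :: "mat3 \<times> mat3 \<Rightarrow> mat3 \<times> mat3 \<Rightarrow> bool" where
  "sim_conj p q \<longleftrightarrow> (\<exists>g. invertible g \<and>
     fst q = g ** fst p ** matrix_inv g \<and> snd q = g ** snd p ** matrix_inv g)"

inductive_set pair_polys :: "(mat3 \<times> mat3 \<Rightarrow> complex) set" where
  const: "(\<lambda>_. c) \<in> pair_polys"
| entry_fst: "(\<lambda>p. fst p $ i $ j) \<in> pair_polys"
| entry_snd: "(\<lambda>p. snd p $ i $ j) \<in> pair_polys"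
| add: "f \<in> pair_polys \<Longrightarrow> g \<in> pair_polys \<Longrightarrow> (\<lambda>p. f p + g p) \<in> pair_polys"
| mult: "f \<in> pair_polys \<Longrightarrow> g \<in> pair_polys \<Longrightarrow> (\<lambda>p. f p * g p) \<in> pair_polys"

text \<open>The regular functions on the product of the two general linear groups also involve the
  inverses of the two determinants; as these are units, polynomials in the entries already
  define all the Zariski-closed subsets.\<close>

definition zariski_open :: "(mat3 \<times> mat3) set \<Rightarrow> bool" where
  "zariski_open \<Omega> \<longleftrightarrow>
     (\<exists>F \<subseteq> pair_polys. \<Omega> = {p \<in> GL3 \<times> GL3. \<exists>f\<in>F. f p \<noteq> 0})"

definition conj_invariant :: "(mat3 \<times> mat3) set \<Rightarrow> bool" where
  "conj_invariant \<Omega> \<longleftrightarrow> (\<forall>p q. p \<in> \<Omega> \<longrightarrow> sim_conj p q \<longrightarrow> q \<in> \<Omega>)"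

text \<open>The matrix \<open>mat c ** A\<close> is the scalar multiple of \<open>A\<close> by \<open>c\<close>. A ternary form over the
  infinite field of complex numbers is identified with the function it defines.\<close>

definition spectral_form :: "mat3 \<Rightarrow> mat3 \<Rightarrow> complex \<Rightarrow> complex \<Rightarrow> complex \<Rightarrow> complex" where
  "spectral_form A B l m n = det (mat l + mat m ** A + mat n ** B)"

definition eigenvalues :: "mat3 \<Rightarrow> complex set" where
  "eigenvalues A = {c. \<exists>v. v \<noteq> 0 \<and> A *v v = c *s v}"

text \<open>A list of the eigenvalues without repetition; since \<open>h\<close> has three entries, this forces
  \<open>A\<close> to have three distinct eigenvalues.\<close>

definition eigenvalue_ordering :: "mat3 \<Rightarrow> complex^3 \<Rightarrow> bool" where
  "eigenvalue_ordering A h \<longleftrightarrow> bij_betw (\<lambda>i. h $ i) UNIV (eigenvalues A)"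

text \<open>The eigenbasis is given by the columns of \<open>P\<close>.\<close>

definition eigenbasis :: "mat3 \<Rightarrow> complex^3 \<Rightarrow> mat3 \<Rightarrow> bool" where
  "eigenbasis A h P \<longleftrightarrow>
     invertible P \<and> (\<forall>j. A *v column j P = h $ j *s column j P)"

definition in_basis :: "mat3 \<Rightarrow> mat3 \<Rightarrow> mat3" where
  "in_basis P B = matrix_inv P ** B ** P"

definition dist_L :: "complex^3 \<Rightarrow> mat3 \<Rightarrow> complex" where
  "dist_L h U =
     (U$1$2 * h$3 * (U$1$2 * U$2$3 - U$1$3 * U$2$2) + U$1$3 * h$2 * (U$1$2 * U$3$3 - U$1$3 * U$3$2))
     / (U$1$2 * U$1$3 * (h$3 - h$2))"

definition dist_M :: "complex^3 \<Rightarrow> mat3 \<Rightarrow> complex" where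
  "dist_M h U =
     - (U$1$2 * (U$1$2 * U$2$3 - U$1$3 * U$2$2) + U$1$3 * (U$1$2 * U$3$3 - U$1$3 * U$3$2))
     / (U$1$2 * U$1$3 * (h$3 - h$2))"

text \<open>The point of the complex projective plane with the given homogeneous coordinates, as a
  line through the origin; meaningful only if the coordinates are not all zero.\<close>

definition proj_point :: "complex \<Rightarrow> complex \<Rightarrow> complex \<Rightarrow> (complex^3) set" where
  "proj_point x y z = vec.span {vector [x, y, z]}"

text \<open>For \<open>U = in_basis P B\<close> with \<open>P\<close> an eigenbasis of \<open>A\<close> ordered by \<open>h\<close>, this is the
  distinguished point of \<open>(A, B)\<close>, defined provided that \<open>dist_defined h U\<close> holds.\<close>

definition dist_defined :: "complex^3 \<Rightarrow> mat3 \<Rightarrow> bool" where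
  "dist_defined h U \<longleftrightarrow> U$1$2 * U$1$3 \<noteq> 0 \<and> h$2 \<noteq> h$3"

definition dist_point :: "complex^3 \<Rightarrow> mat3 \<Rightarrow> (complex^3) set" where
  "dist_point h U = proj_point (dist_L h U) (dist_M h U) 1"

end

theory Submission
  imports Defs "HOL-Computational_Algebra.Fundamental_Theorem_Algebra"
begin

text \<open>A pair is in general position when \<open>A\<close> has distinct eigenvalues and, in an eigenbasis of
  \<open>A\<close>, all off-diagonal entries of the matrix \<open>U\<close> of \<open>B\<close> are nonzero. This is the
  nonvanishing of two conjugation-invariant polynomials: the discriminant of the characteristic
  polynomial of \<open>A\<close>, and a Gram determinant built from traces of words in \<open>A\<close> and \<open>[A, B]\<close>.

  Two eigenbases with the same ordering differ by a diagonal rescaling, which preserves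
  \<open>L + M h\<^sub>2 = u\<^sub>1\<^sub>2 u\<^sub>2\<^sub>3 / u\<^sub>1\<^sub>3 - u\<^sub>2\<^sub>2\<close> and
  \<open>L + M h\<^sub>3 = u\<^sub>1\<^sub>3 u\<^sub>3\<^sub>2 / u\<^sub>1\<^sub>2 - u\<^sub>3\<^sub>3\<close>, hence \<open>L\<close> and \<open>M\<close>.
  Conversely, the spectral curve determines the \<open>u\<^sub>i\<^sub>i\<close> and two linear combinations of the
  products \<open>u\<^sub>i\<^sub>j u\<^sub>j\<^sub>i\<close>. The distinguished point then gives the two quotients, whose
  product is \<open>u\<^sub>2\<^sub>3 u\<^sub>3\<^sub>2\<close>, so all three products are known. Once the basis is
  rescaled to fix \<open>u\<^sub>1\<^sub>2\<close> and \<open>u\<^sub>1\<^sub>3\<close>, every entry of \<open>U\<close> is determined.\<close>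

section \<open>Intertwining and the conjugation invariants\<close>

definition intertwines :: "'a::field^'n^'n \<Rightarrow> 'a^'n^'n \<Rightarrow> 'a^'n^'n \<Rightarrow> bool" where
  "intertwines P X Y \<longleftrightarrow> X ** P = P ** Y"

definition diag :: "'a::field^'n \<Rightarrow> 'a^'n^'n" where
  "diag h = (\<chi> i j. if i = j then h $ i else 0)"

definition comm :: "'a::field^'n^'n \<Rightarrow> 'a^'n^'n \<Rightarrow> 'a^'n^'n" where
  "comm A B = A ** B - B ** A"

text \<open>The second elementary symmetric function of the eigenvalues. Written through traces, it
  inherits their invariance and polynomiality.\<close>

definition minors2 :: "mat3 \<Rightarrow> complex" where
  "minors2 A = ((trace A)\<^sup>2 - trace (A ** A)) / 2"

text \<open>The discriminant of the monic cubic \<open>x^3 - T x^2 + E x - D\<close>.\<close>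

definition disc :: "complex \<Rightarrow> complex \<Rightarrow> complex \<Rightarrow> complex" where
  "disc T E D = T\<^sup>2 * E\<^sup>2 - 4 * E^3 - 4 * T^3 * D + 18 * T * E * D - 27 * D\<^sup>2"

definition char_disc :: "mat3 \<Rightarrow> complex" where
  "char_disc A = disc (trace A) (minors2 A) (det A)"

text \<open>With \<open>A\<close> diagonal, \<open>Q\<^sub>i\<^sub>j = - C\<^sub>i\<^sub>j C\<^sub>j\<^sub>i\<close>, and the functions \<open>1\<close>, \<open>h\<^sub>i + h\<^sub>j\<close>,
  \<open>h\<^sub>i h\<^sub>j\<close> on the three pairs \<open>i < j\<close>, \<open>gram\<close> is up to sign and a factor 8 the determinant of
  their Gram matrix with respect to the weights \<open>Q\<^sub>i\<^sub>j\<close>. Hence it is the product of the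
  weights times the squared determinant of the three functions. Its entries are traces of words in
  \<open>A\<close> and \<open>C\<close>, so \<open>gram\<close> is an invariant polynomial in the entries of \<open>A\<close> and \<open>B\<close>.\<close>

definition gram :: "mat3 \<Rightarrow> mat3 \<Rightarrow> complex" where
  "gram A B = (let C = comm A B;
     a = trace (C ** C);
     b = 2 * trace (A ** C ** C);
     c = trace (A ** C ** (A ** C));
     d = 2 * trace (A ** A ** C ** C) + 2 * trace (A ** C ** (A ** C));
     e = 2 * trace (A ** A ** C ** (A ** C));
     g = trace (A ** A ** C ** (A ** A ** C))
   in a * d * g + 2 * b * e * c - a * e\<^sup>2 - d * c\<^sup>2 - g * b\<^sup>2)"

lemma matrix_inv_left: "invertible (P::'a::field^'n^'n) \<Longrightarrow> matrix_inv P ** P = mat 1"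
  and matrix_inv_right: "invertible (P::'a::field^'n^'n) \<Longrightarrow> P ** matrix_inv P = mat 1"
  unfolding matrix_inv_def invertible_def by (metis (mono_tags, lifting) someI_ex)+

lemma matrix_add_rdistrib: "(B + C) ** A = B ** A + C ** A"
  for A :: "'a::field^'n^'m"
  by (simp add: matrix_matrix_mult_def vec_eq_iff sum.distrib algebra_simps)

lemma matrix_diff_ldistrib: "A ** (B - C) = A ** B - A ** C"
  for A :: "'a::field^'n^'m"
  by (simp add: matrix_matrix_mult_def vec_eq_iff sum_subtractf algebra_simps)

lemma matrix_diff_rdistrib: "(B - C) ** A = B ** A - C ** A"
  for A :: "'a::field^'n^'m"
  by (simp add: matrix_matrix_mult_def vec_eq_iff sum_subtractf algebra_simps)

lemma diag_mult: "(diag h ** X) $ i $ j = h$i * X$i$j"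
  by (simp add: diag_def matrix_matrix_mult_def if_distrib[of "\<lambda>x. x * _"] cong: if_cong)

lemma mult_diag: "(X ** diag h) $ i $ j = X$i$j * h$j"
  by (simp add: diag_def matrix_matrix_mult_def if_distrib[of "\<lambda>x. _ * x"] cong: if_cong)

lemma mat_eq_diag: "mat c = diag (\<chi> i. c)"
  by (simp add: mat_def diag_def vec_eq_iff)

lemma mat_commute: "mat c ** P = P ** mat c" for P :: "'a::field^'n^'n"
  by (simp add: mat_eq_diag vec_eq_iff diag_mult mult_diag)

lemma intertwines_mat: "intertwines P (mat c) (mat c)"
  by (simp add: intertwines_def mat_commute)

text \<open>Being free of inverses, the relation passes to products for every \<open>P\<close>.
  Together with sums and differences, this carries each word in \<open>A\<close> and
  \<open>B\<close> over to the new basis.\<close>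

lemma intertwines_mult:
  "intertwines P X Y \<Longrightarrow> intertwines P X' Y' \<Longrightarrow> intertwines P (X ** X') (Y ** Y')"
  unfolding intertwines_def by (metis matrix_mul_assoc)

lemma intertwines_add:
  "intertwines P X Y \<Longrightarrow> intertwines P X' Y' \<Longrightarrow> intertwines P (X + X') (Y + Y')"
  unfolding intertwines_def by (simp add: matrix_add_ldistrib matrix_add_rdistrib)

lemma intertwines_diff:
  "intertwines P X Y \<Longrightarrow> intertwines P X' Y' \<Longrightarrow> intertwines P (X - X') (Y - Y')"
  unfolding intertwines_def by (simp add: matrix_diff_ldistrib matrix_diff_rdistrib)

lemma intertwines_comm:
  "intertwines P X Y \<Longrightarrow> intertwines P X' Y' \<Longrightarrow> intertwines P (comm X X') (comm Y Y')"
  unfolding comm_def by (intro intertwines_diff intertwines_mult)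

lemma intertwines_in_basis: "invertible P \<Longrightarrow> intertwines P B (in_basis P B)"
  unfolding intertwines_def in_basis_def
  by (metis matrix_inv_right matrix_mul_assoc matrix_mul_lid)

lemma intertwines_unique:
  assumes "invertible P" "intertwines P B Y" shows "Y = in_basis P B"
  using assms unfolding intertwines_def in_basis_def
  by (metis matrix_inv_left matrix_mul_assoc matrix_mul_lid)

lemma trace_intertwines:
  assumes P: "invertible P" and i: "intertwines P X Y"
  shows "trace X = trace Y"
proof -
  have "trace Y = trace (matrix_inv P ** (X ** P))"
    using i by (simp add: intertwines_def matrix_mul_assoc matrix_inv_left[OF P])
  also have "\<dots> = trace ((X ** P) ** matrix_inv P)" by (rule trace_mul_sym)
  also have "\<dots> = trace X" by (simp add: matrix_inv_right[OF P] flip: matrix_mul_assoc)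
  finally show ?thesis ..
qed

lemma det_intertwines:
  assumes P: "invertible P" and i: "intertwines P X Y"
  shows "det X = det Y"
  using i P unfolding intertwines_def invertible_det_nz by (metis det_mul mult.commute mult_cancel_left)

lemma char_disc_intertwines:
  assumes "invertible P" "intertwines P X Y"
  shows "char_disc X = char_disc Y"
  using trace_intertwines[OF assms] det_intertwines[OF assms]
    trace_intertwines[OF assms(1) intertwines_mult[OF assms(2) assms(2)]]
  by (simp add: char_disc_def minors2_def)

lemma gram_intertwines:
  assumes P: "invertible P" and A: "intertwines P A A'" and B: "intertwines P B B'"
  shows "gram A B = gram A' B'"
proof -
  note C = intertwines_comm[OF A B]
  note t = trace_intertwines[OF P]
  show ?thesis
    unfolding gram_def Let_def
    by (intro arg_cong2[of _ _ _ _ "(+)"] arg_cong2[of _ _ _ _ "(-)"] arg_cong2[of _ _ _ _ "(*)"]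
        arg_cong2[of _ _ _ _ "(^)"] refl t intertwines_mult A C)
qed

lemma gram_diag:
  "gram (diag h) U =
    - 8 * ((h$1 - h$2) * (h$1 - h$3) * (h$2 - h$3))^4 *
      (U$1$2 * U$2$1 * U$1$3 * U$3$1 * U$2$3 * U$3$2)"
proof -
  define C where "C = comm (diag h) U"
  define x y z where "x = C$1$2 * C$2$1" and "y = C$1$3 * C$3$1" and "z = C$2$3 * C$3$2"
  have C: "C$i$j = (h$i - h$j) * U$i$j" for i j
    by (simp add: C_def comm_def diag_mult mult_diag algebra_simps)
  have C0: "C$i$i = 0" for i by (simp add: C)
  have t: "trace (X ** Y) = (\<Sum>i\<in>UNIV. \<Sum>j\<in>UNIV. X$i$j * Y$j$i)" for X Y :: mat3
    by (simp add: trace_def matrix_matrix_mult_def)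
  \<comment> \<open>Entries of the symmetric Gram matrix with rows \<open>a b c\<close>,
    \<open>b d e\<close>, \<open>c e g\<close>, for the weights \<open>x\<close>, \<open>y\<close>,
    \<open>z\<close>.\<close>
  define a b c d e g where
    "a = x + y + z" and
    "b = (h$1 + h$2) * x + (h$1 + h$3) * y + (h$2 + h$3) * z" and
    "c = h$1 * h$2 * x + h$1 * h$3 * y + h$2 * h$3 * z" and
    "d = (h$1 + h$2)\<^sup>2 * x + (h$1 + h$3)\<^sup>2 * y + (h$2 + h$3)\<^sup>2 * z" and
    "e = (h$1 + h$2) * (h$1 * h$2) * x + (h$1 + h$3) * (h$1 * h$3) * y + (h$2 + h$3) * (h$2 * h$3) * z" and
    "g = (h$1 * h$2)\<^sup>2 * x + (h$1 * h$3)\<^sup>2 * y + (h$2 * h$3)\<^sup>2 * z"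
  note m = t diag_mult C0 sum_3 x_def y_def z_def power2_eq_square algebra_simps
  have as: "diag h ** diag h ** C = diag h ** (diag h ** C)"
    by (simp add: matrix_mul_assoc)
  have 1: "trace (C ** C) = 2 * a"
    by (simp add: m a_def)
  have 2: "2 * trace (diag h ** C ** C) = 2 * b"
    by (simp add: m b_def)
  have 3: "trace (diag h ** C ** (diag h ** C)) = 2 * c"
    by (simp add: m c_def)
  \<comment> \<open>Here \<open>h_i^2 + h_j^2 = (h_i + h_j)^2 - 2 h_i h_j\<close>; the second trace
    in the \<open>d\<close> of \<open>gram\<close> restores the square of the sum.\<close>
  have 4: "2 * trace (diag h ** diag h ** C ** C) = 2 * (d - 2 * c)"
    by (simp add: as m c_def d_def)
  have 5: "2 * trace (diag h ** diag h ** C ** (diag h ** C)) = 2 * e"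
    by (simp add: as m e_def)
  have 6: "trace (diag h ** diag h ** C ** (diag h ** diag h ** C)) = 2 * g"
    by (simp add: as m g_def)
  have "gram (diag h) U = 8 * (a * d * g + 2 * b * e * c - a * e\<^sup>2 - d * c\<^sup>2 - g * b\<^sup>2)"
    unfolding gram_def C_def[symmetric] Let_def 1 2 3 4 5 6
    by (simp add: power2_eq_square algebra_simps)
  \<comment> \<open>The determinant of the three functions is, up to sign, the Vandermonde product
    of \<open>h\<close>.\<close>
  also have "a * d * g + 2 * b * e * c - a * e\<^sup>2 - d * c\<^sup>2 - g * b\<^sup>2 =
      ((h$1 - h$2) * (h$1 - h$3) * (h$2 - h$3))\<^sup>2 * (x * y * z)"
    unfolding a_def b_def c_def d_def e_def g_def by algebra
  \<comment> \<open>Each weight is \<open>C_ij C_ji = - (h_i - h_j)^2 u_ij u_ji\<close>, and three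
    signs leave one minus.\<close>
  also have "x * y * z = - (((h$1 - h$2) * (h$1 - h$3) * (h$2 - h$3))\<^sup>2 *
      (U$1$2 * U$2$1 * U$1$3 * U$3$1 * U$2$3 * U$3$2))"
    unfolding x_def y_def z_def C by algebra
  finally show ?thesis by algebra
qed

section \<open>Eigenvalues and eigenbases\<close>

lemma distinct3:
  fixes h :: "complex^3"
  assumes "inj (\<lambda>i. h$i)"
  shows "h$1 \<noteq> h$2" "h$1 \<noteq> h$3" "h$2 \<noteq> h$3"
  using injD[OF assms, of 1 2] injD[OF assms, of 1 3] injD[OF assms, of 2 3] by auto

lemma det_mat_minus: "det (mat x - A) = x^3 - trace A * x\<^sup>2 + minors2 A * x - det A" for A :: mat3
  by (simp add: det_3 trace_def minors2_def sum_3 matrix_matrix_mult_def mat_def field_simps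
      power2_eq_square power3_eq_cube)

lemma mat_mult_vec: "mat x *v v = x *s v" for v :: "complex^3"
  using exhaust_3 by (auto simp: vec_eq_iff matrix_vector_mult_def mat_def sum_3 forall_3)

lemma eigenvalues_eq_roots: "eigenvalues A = {x. det (mat x - A) = 0}"
proof -
  have "det (mat x - A) = 0 \<longleftrightarrow> (\<exists>v. v \<noteq> 0 \<and> A *v v = x *s v)" for x
  proof -
    have "det (mat x - A) = 0 \<longleftrightarrow> (\<exists>v. v \<noteq> 0 \<and> (mat x - A) *v v = 0)"
      using invertible_det_nz[of "mat x - A"]
      unfolding invertible_left_inverse matrix_left_invertible_ker by blast
    then show ?thesis
      by (auto simp: matrix_vector_mult_diff_rdistrib mat_mult_vec)
  qed
  then show ?thesis by (auto simp: eigenvalues_def)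
qed

text \<open>Vieta's formulas: \<open>a\<close> is a root of the cubic, \<open>b\<close> a root of
  its quotient by \<open>x - a\<close> (coefficients \<open>g\<close>), and the sum of the roots
  forces \<open>T - a - b\<close> as the third.\<close>

lemma cubic_splits:
  fixes T E D :: complex
  obtains a b c where "T = a + b + c" "E = a * b + a * c + b * c" "D = a * b * c"
proof -
  define f where "f = (\<lambda>k::nat. if k = 3 then 1 else if k = 2 then - T else if k = 1 then E else - D)"
  obtain a where "(\<Sum>k\<le>3. f k * a ^ k) = 0"
    using alg_closed[of 3 f] by (auto simp: f_def)
  then have a: "a^3 - T * a\<^sup>2 + E * a - D = 0"
    by (simp add: f_def numeral_eq_Suc algebra_simps)
  define g where "g = (\<lambda>k::nat. if k = 2 then 1 else if k = 1 then a - T else a\<^sup>2 - T * a + E)"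
  obtain b where "(\<Sum>k\<le>2. g k * b ^ k) = 0"
    using alg_closed[of 2 g] by (auto simp: g_def)
  then have b: "b\<^sup>2 + (a - T) * b + (a\<^sup>2 - T * a + E) = 0"
    by (simp add: g_def numeral_eq_Suc algebra_simps)
  have "E = a * b + a * (T - a - b) + b * (T - a - b)"
    using b by algebra
  moreover from this have "D = a * b * (T - a - b)"
    using a by algebra
  ultimately show thesis
    by (intro that[of a b "T - a - b"]) simp_all
qed

lemma disc_eq:
  "disc (a + b + c) (a * b + a * c + b * c) (a * b * c) = ((a - b) * (a - c) * (b - c))\<^sup>2"
  unfolding disc_def by algebra

lemma card_eigenvalues:
  assumes "char_disc A \<noteq> 0"
  shows "card (eigenvalues A) = 3"
proof -
  obtain a b c where e: "trace A = a + b + c" "minors2 A = a * b + a * c + b * c" "det A = a * b * c"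
    by (rule cubic_splits)
  have "det (mat x - A) = (x - a) * (x - b) * (x - c)" for x
    unfolding det_mat_minus e by algebra
  then have "eigenvalues A = {a, b, c}"
    by (auto simp: eigenvalues_eq_roots)
  moreover have "a \<noteq> b" "a \<noteq> c" "b \<noteq> c"
    using assms unfolding char_disc_def e disc_eq by auto
  ultimately show ?thesis by simp
qed

lemma char_disc_diag:
  "char_disc (diag h) = ((h$1 - h$2) * (h$1 - h$3) * (h$2 - h$3))\<^sup>2"
proof -
  have "minors2 (diag h) = h$1 * h$2 + h$1 * h$3 + h$2 * h$3"
    by (simp add: minors2_def trace_def diag_mult sum_3)
      (simp add: diag_def field_simps power2_eq_square)
  moreover have "trace (diag h) = h$1 + h$2 + h$3" "det (diag h) = h$1 * h$2 * h$3"
    by (simp_all add: trace_def det_3 diag_def sum_3)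
  ultimately show ?thesis
    by (simp add: char_disc_def disc_eq)
qed

lemma mult_column: "(A *v column j P) $ i = (A ** P) $ i $ j"
  by (simp add: matrix_vector_mult_def matrix_matrix_mult_def column_def)

lemma eigenbasis_iff: "eigenbasis A h P \<longleftrightarrow> invertible P \<and> intertwines P A (diag h)"
proof -
  have "(\<forall>j. A *v column j P = h$j *s column j P) \<longleftrightarrow> A ** P = P ** diag h"
    by (auto simp: vec_eq_iff mult_diag mult_column) (simp_all add: column_def mult.commute)
  then show ?thesis
    by (simp add: eigenbasis_def intertwines_def)
qed

text \<open>Eigenvectors for distinct eigenvalues are independent: the kernel of \<open>P\<close> is
  stable under \<open>diag h\<close>, so with \<open>x\<close> it contains the vectors with entries
  \<open>h_j x_j\<close> and \<open>h_j^2 x_j\<close>, and a Vandermonde system isolates each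
  \<open>x_j v_j\<close>.\<close>

lemma eigenbasis_exists:
  assumes "eigenvalue_ordering A h"
  shows "\<exists>P. eigenbasis A h P"
proof -
  have i: "inj (\<lambda>i. h$i)" and "\<forall>j. h$j \<in> eigenvalues A"
    using assms by (auto simp: eigenvalue_ordering_def bij_betw_def)
  then obtain v where v: "\<And>j. v j \<noteq> 0" "\<And>j. A *v v j = h$j *s v j"
    unfolding eigenvalues_def by (auto simp: choice_iff)
  define P :: mat3 where "P = (\<chi> i j. v j $ i)"
  have c: "column j P = v j" for j
    by (simp add: P_def column_def vec_eq_iff)
  have P: "intertwines P A (diag h)"
    using v(2) unfolding c[symmetric]
    by (simp add: intertwines_def vec_eq_iff mult_diag mult_column) (simp add: column_def mult.commute)
  have "x = 0" if x: "P *v x = 0" for x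
  proof -
    have "P *v (diag h *v y) = 0" if "P *v y = 0" for y
      using P that by (metis intertwines_def matrix_vector_mul_assoc matrix_vector_mult_0_right)
    moreover have "(diag h *v y) $ j = h$j * y$j" for y j
      using exhaust_3[of j] by (auto simp: matrix_vector_mult_def diag_def sum_3)
    ultimately have "P *v (\<chi> j. h$j * y$j) = 0" if "P *v y = 0" for y
      using that by (metis (no_types, lifting) vec_eq_iff vec_lambda_beta)
    from this[OF x] this[OF this[OF x]]
    have p: "P *v (\<chi> j. h$j * x$j) = 0" "P *v (\<chi> j. h$j * (h$j * x$j)) = 0" by simp_all
    have "x$1 * v 1 $ i = 0 \<and> x$2 * v 2 $ i = 0 \<and> x$3 * v 3 $ i = 0" for i
    proof -
      have "x$1 * v 1 $ i + x$2 * v 2 $ i + x$3 * v 3 $ i = 0"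
        "h$1 * (x$1 * v 1 $ i) + h$2 * (x$2 * v 2 $ i) + h$3 * (x$3 * v 3 $ i) = 0"
        "h$1 * h$1 * (x$1 * v 1 $ i) + h$2 * h$2 * (x$2 * v 2 $ i) + h$3 * h$3 * (x$3 * v 3 $ i) = 0"
        using p x by (simp_all add: vec_eq_iff matrix_vector_mult_def sum_3 P_def algebra_simps)
      then have "(h$1 - h$2) * (h$1 - h$3) * (x$1 * v 1 $ i) = 0"
        "(h$1 - h$2) * (h$2 - h$3) * (x$2 * v 2 $ i) = 0"
        "(h$1 - h$3) * (h$2 - h$3) * (x$3 * v 3 $ i) = 0"
        by algebra+
      with distinct3[OF i] show ?thesis by simp
    qed
    then have "x$1 *s v 1 = 0" "x$2 *s v 2 = 0" "x$3 *s v 3 = 0"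
      by (simp_all add: vec_eq_iff)
    then show ?thesis using v(1) by (simp add: vec_eq_iff[of x] forall_3)
  qed
  then have "invertible P"
    unfolding invertible_left_inverse matrix_left_invertible_ker by blast
  with P show ?thesis by (auto simp: eigenbasis_iff)
qed

section \<open>Rescaling of eigenbases and the distinguished point\<close>

lemma in_basis_rescale:
  assumes P: "eigenbasis A h P" and P': "eigenbasis A h P'" and h: "inj (\<lambda>i. h$i)"
  shows "\<exists>q. (\<forall>i. q i \<noteq> 0) \<and> (\<forall>i j. q i * in_basis P' B $ i $ j = in_basis P B $ i $ j * q j)"
proof -
  have iP: "invertible P" "invertible P'"
    and AP: "A ** P = P ** diag h" "A ** P' = P' ** diag h"
    using P P' by (simp_all add: eigenbasis_iff intertwines_def)
  define Q where "Q = matrix_inv P ** P'"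
  have PQ: "P' = P ** Q"
    by (simp add: Q_def matrix_mul_assoc matrix_inv_right[OF iP(1)])
  have cancel: "X = Y" if "P ** X = P ** Y" for X Y :: mat3
    using that by (metis iP(1) matrix_inv_left matrix_mul_assoc matrix_mul_lid)
  \<comment> \<open>The change of basis \<open>Q\<close> commutes with \<open>diag h\<close>; as the
    \<open>h_i\<close> are distinct, it must be diagonal.\<close>
  have "P ** (diag h ** Q) = P ** (Q ** diag h)"
    using AP PQ by (metis matrix_mul_assoc)
  then have "diag h ** Q = Q ** diag h" by (rule cancel)
  then have "h$i * Q$i$j = Q$i$j * h$j" for i j
    by (metis diag_mult mult_diag)
  then have off: "Q$i$j = 0" if "i \<noteq> j" for i j
    using h that by (metis injD mult.commute mult_cancel_left)
  define q where "q = (\<chi> i. Q$i$i)"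
  have Q: "Q = diag q"
    using off by (auto simp: q_def diag_def vec_eq_iff)
  have "det P' = det P * det Q" by (simp add: PQ det_mul)
  then have "det Q \<noteq> 0" using iP by (auto simp: invertible_det_nz)
  then have "q$1 \<noteq> 0" "q$2 \<noteq> 0" "q$3 \<noteq> 0"
    unfolding Q by (auto simp: det_3 diag_def)
  then have "q$i \<noteq> 0" for i using exhaust_3[of i] by auto
  moreover have "P ** (in_basis P B ** Q) = P ** (Q ** in_basis P' B)"
    using intertwines_in_basis[OF iP(1), of B] intertwines_in_basis[OF iP(2), of B] PQ
    unfolding intertwines_def by (metis matrix_mul_assoc)
  then have "in_basis P B ** Q = Q ** in_basis P' B" by (rule cancel)
  then have "q$i * in_basis P' B $ i $ j = in_basis P B $ i $ j * q$j" for i j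
    unfolding Q by (metis diag_mult mult_diag)
  ultimately show ?thesis by (intro exI[of _ "\<lambda>i. q$i"]) auto
qed

text \<open>The two rows below the first of \<open>(\<lambda> + \<mu> A + B) v = 0\<close> for \<open>v = (0, u\<^sub>1\<^sub>3, - u\<^sub>1\<^sub>2)\<close>.\<close>

lemma dist_eqs:
  assumes "dist_defined h U"
  shows "dist_L h U + dist_M h U * h$2 = U$1$2 * U$2$3 / U$1$3 - U$2$2"
    and "dist_L h U + dist_M h U * h$3 = U$1$3 * U$3$2 / U$1$2 - U$3$3"
proof -
  have "U$1$2 \<noteq> 0" "U$1$3 \<noteq> 0" "h$3 - h$2 \<noteq> 0"
    using assms by (auto simp: dist_defined_def)
  then show "dist_L h U + dist_M h U * h$2 = U$1$2 * U$2$3 / U$1$3 - U$2$2"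
    and "dist_L h U + dist_M h U * h$3 = U$1$3 * U$3$2 / U$1$2 - U$3$3"
    unfolding dist_L_def dist_M_def
    by (simp add: divide_simps; algebra)+
qed

text \<open>In \<open>u_12 u_23 / u_13\<close> the factors
  \<open>(q_2/q_1) (q_3/q_2) / (q_3/q_1)\<close> cancel, and likewise in the other quotient of
  \<open>dist_eqs\<close>. The two linear equations for \<open>L\<close> and \<open>M\<close> have a
  unique solution because \<open>h_2\<close> and \<open>h_3\<close> differ.\<close>

lemma dist_point_rescale:
  assumes d: "dist_defined h U" "dist_defined h U'" and q: "\<And>i. q i \<noteq> 0"
    and r: "\<And>i j. q i * U' $ i $ j = U $ i $ j * q j"
  shows "dist_point h U = dist_point h U'"
proof -
  have U': "U'$i$j = U$i$j * q j / q i" for i j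
    using r[of i j] q[of i] by (simp add: field_simps)
  have nz: "U$1$2 \<noteq> 0" "U$1$3 \<noteq> 0" "h$2 \<noteq> h$3"
    using d by (auto simp: dist_defined_def)
  have "dist_L h U + dist_M h U * h$2 = dist_L h U' + dist_M h U' * h$2"
    "dist_L h U + dist_M h U * h$3 = dist_L h U' + dist_M h U' * h$3"
    unfolding dist_eqs[OF d(1)] dist_eqs[OF d(2)] using q nz by (simp_all add: U')
  then have "dist_M h U * (h$2 - h$3) = dist_M h U' * (h$2 - h$3)"
    by algebra
  then have "dist_M h U = dist_M h U'" using nz by simp
  moreover from this have "dist_L h U = dist_L h U'"
    using \<open>dist_L h U + dist_M h U * h$2 = _\<close> by simp
  ultimately show ?thesis by (simp add: dist_point_def)
qed

text \<open>The last coordinate 1 forces the proportionality factor to be 1.\<close>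

lemma dist_point_eqD:
  assumes "dist_point h U = dist_point h U'"
  shows "dist_L h U = dist_L h U'" "dist_M h U = dist_M h U'"
proof -
  have "vector [dist_L h U, dist_M h U, 1] \<in> vec.span {vector [dist_L h U', dist_M h U', 1] :: complex^3}"
    using assms vec.span_base[of _ "{vector [dist_L h U, dist_M h U, 1] :: complex^3}"]
    by (auto simp: dist_point_def proj_point_def)
  then obtain k where "vector [dist_L h U, dist_M h U, 1] = k *s (vector [dist_L h U', dist_M h U', 1] :: complex^3)"
    by (auto simp: vec.span_singleton)
  then show "dist_L h U = dist_L h U'" "dist_M h U = dist_M h U'"
    by (simp_all add: vec_eq_iff forall_3)
qed

section \<open>The spectral curve and reconstruction\<close>

lemma spectral_form_intertwines:
  assumes P: "invertible P" and "intertwines P A A'" "intertwines P B B'"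
  shows "spectral_form A B = spectral_form A' B'"
  unfolding spectral_form_def
  by (intro ext det_intertwines[OF P] intertwines_add intertwines_mult intertwines_mat assms)

lemma spectral_form_diag:
  "spectral_form (diag h) U l m n =
    (l + m * h$1) * (l + m * h$2) * (l + m * h$3)
    + n * ((l + m * h$2) * (l + m * h$3) * U$1$1 + (l + m * h$1) * (l + m * h$3) * U$2$2
        + (l + m * h$1) * (l + m * h$2) * U$3$3)
    + n\<^sup>2 * ((l + m * h$1) * (U$2$2 * U$3$3 - U$2$3 * U$3$2)
        + (l + m * h$2) * (U$1$1 * U$3$3 - U$1$3 * U$3$1)
        + (l + m * h$3) * (U$1$1 * U$2$2 - U$1$2 * U$2$1))
    + n^3 * det U"
proof -
  have "mat m ** X = (\<chi> i j. m * X$i$j)" for m and X :: mat3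
    by (simp add: mat_eq_diag vec_eq_iff diag_mult)
  then show ?thesis
    by (simp add: spectral_form_def det_3) (simp add: mat_def diag_def power2_eq_square power3_eq_cube algebra_simps)
qed

lemma spectral_form_diag_eqD:
  assumes eq: "spectral_form (diag h) U = spectral_form (diag h) V" and h: "inj (\<lambda>i. h$i)"
  shows "U$i$i = V$i$i"
    and "U$1$2 * U$2$1 + U$1$3 * U$3$1 + U$2$3 * U$3$2 = V$1$2 * V$2$1 + V$1$3 * V$3$1 + V$2$3 * V$3$2"
    and "h$3 * (U$1$2 * U$2$1) + h$2 * (U$1$3 * U$3$1) + h$1 * (U$2$3 * U$3$2)
      = h$3 * (V$1$2 * V$2$1) + h$2 * (V$1$3 * V$3$1) + h$1 * (V$2$3 * V$3$2)"
proof -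
  define a where "a U l m = (l + m * h$2) * (l + m * h$3) * U$1$1 + (l + m * h$1) * (l + m * h$3) * U$2$2
        + (l + m * h$1) * (l + m * h$2) * U$3$3" for U :: mat3 and l m
  define b where "b U l m = (l + m * h$1) * (U$2$2 * U$3$3 - U$2$3 * U$3$2)
        + (l + m * h$2) * (U$1$1 * U$3$3 - U$1$3 * U$3$1)
        + (l + m * h$3) * (U$1$1 * U$2$2 - U$1$2 * U$2$1)" for U :: mat3 and l m
  have *: "n * a U l m + n\<^sup>2 * b U l m + n^3 * det U = n * a V l m + n\<^sup>2 * b V l m + n^3 * det V" for l m n
    using fun_cong[OF fun_cong[OF fun_cong[OF eq, of l], of m], of n]
    unfolding spectral_form_diag a_def b_def by algebra
  \<comment> \<open>The values 1, -1, 2 of \<open>n\<close> give a nonsingular system for the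
    coefficients of \<open>n\<close>, \<open>n^2\<close> and \<open>n^3\<close>.\<close>
  have a: "a U l m = a V l m" and b: "b U l m = b V l m" for l m
    using *[of 1 l m] *[of "-1" l m] *[of 2 l m] by (simp_all, algebra+)
  \<comment> \<open>At \<open>l = - h_i\<close>, \<open>m = 1\<close> only the term of
    \<open>a\<close> with the \<open>i\<close>-th diagonal entry survives.\<close>
  have "U$1$1 = V$1$1" "U$2$2 = V$2$2" "U$3$3 = V$3$3"
    using a[of "- h$1" 1] a[of "- h$2" 1] a[of "- h$3" 1] distinct3[OF h] by (simp_all add: a_def)
  then show "U$i$i = V$i$i" using exhaust_3[of i] by auto
  show "U$1$2 * U$2$1 + U$1$3 * U$3$1 + U$2$3 * U$3$2 = V$1$2 * V$2$1 + V$1$3 * V$3$1 + V$2$3 * V$3$2"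
    using b[of 1 0] \<open>U$1$1 = _\<close> \<open>U$2$2 = _\<close> \<open>U$3$3 = _\<close> unfolding b_def by algebra
  show "h$3 * (U$1$2 * U$2$1) + h$2 * (U$1$3 * U$3$1) + h$1 * (U$2$3 * U$3$2)
      = h$3 * (V$1$2 * V$2$1) + h$2 * (V$1$3 * V$3$1) + h$1 * (V$2$3 * V$3$2)"
    using b[of 0 1] \<open>U$1$1 = _\<close> \<open>U$2$2 = _\<close> \<open>U$3$3 = _\<close> unfolding b_def by algebra
qed

lemma reconstruction:
  assumes eq: "spectral_form (diag h) U = spectral_form (diag h) V" and h: "inj (\<lambda>i. h$i)"
    and d: "dist_defined h U" "dist_defined h V" and p: "dist_point h U = dist_point h V"
  shows "\<exists>q. (\<forall>i. q i \<noteq> 0) \<and> (\<forall>i j. q i * V$i$j = U$i$j * q j)"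
proof -
  note s = spectral_form_diag_eqD[OF eq h]
  have nz: "U$1$2 \<noteq> 0" "U$1$3 \<noteq> 0" "V$1$2 \<noteq> 0" "V$1$3 \<noteq> 0"
    using d by (auto simp: dist_defined_def)
  have r: "U$1$2 * U$2$3 / U$1$3 = V$1$2 * V$2$3 / V$1$3"
    "U$1$3 * U$3$2 / U$1$2 = V$1$3 * V$3$2 / V$1$2"
    using dist_eqs[OF d(1)] dist_eqs[OF d(2)] dist_point_eqD[OF p] s(1)[of 2] s(1)[of 3] by simp_all
  have "U$2$3 * U$3$2 = (U$1$2 * U$2$3 / U$1$3) * (U$1$3 * U$3$2 / U$1$2)"
    using nz by simp
  also have "\<dots> = V$2$3 * V$3$2"
    unfolding r using nz by simp
  finally have p1: "U$2$3 * U$3$2 = V$2$3 * V$3$2" .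
  \<comment> \<open>Two linear relations remain for \<open>u_12 u_21\<close> and
    \<open>u_13 u_31\<close>, with determinant \<open>h_2 - h_3\<close> up to sign.\<close>
  have "(h$3 - h$2) * (U$1$2 * U$2$1) = (h$3 - h$2) * (V$1$2 * V$2$1)"
    "(h$3 - h$2) * (U$1$3 * U$3$1) = (h$3 - h$2) * (V$1$3 * V$3$1)"
    using s(2,3) p1 by algebra+
  then have p2: "U$1$2 * U$2$1 = V$1$2 * V$2$1" "U$1$3 * U$3$1 = V$1$3 * V$3$1"
    using distinct3[OF h] by simp_all
  \<comment> \<open>rescales the eigenbasis so that the entries (1,2) and (1,3) of \<open>U\<close> become those of \<open>V\<close>\<close>
  define q :: "3 \<Rightarrow> complex" where
    "q i = (if i = 1 then 1 else V$1$i / U$1$i)" for i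
  have q: "q 1 = 1" "q 2 = V$1$2 / U$1$2" "q 3 = V$1$3 / U$1$3"
    by (simp_all add: q_def)
  have "q i \<noteq> 0" for i using exhaust_3[of i] nz by (auto simp: q)
  \<comment> \<open>Row 1 holds by the choice of \<open>q\<close>, column 1 by \<open>p2\<close>,
    the entries (2,3) and (3,2) by \<open>r\<close>, and the diagonal by
    \<open>s(1)\<close>.\<close>
  moreover have "q i * V$i$j = U$i$j * q j" for i j
    using exhaust_3[of i] exhaust_3[of j] nz p2 r s(1)[of i]
    by (auto simp: q field_simps)
  ultimately show ?thesis by blast
qed

section \<open>Polynomiality of the invariants\<close>

definition poly_mat :: "(mat3 \<times> mat3 \<Rightarrow> mat3) \<Rightarrow> bool" where
  "poly_mat F \<longleftrightarrow> (\<forall>i j. (\<lambda>p. F p $ i $ j) \<in> pair_polys)"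

lemma pair_polys_diff:
  assumes "f \<in> pair_polys" "g \<in> pair_polys"
  shows "(\<lambda>p. f p - g p) \<in> pair_polys"
  using pair_polys.add[OF assms(1) pair_polys.mult[OF pair_polys.const[of "-1"] assms(2)]] by simp

lemma pair_polys_power: "f \<in> pair_polys \<Longrightarrow> (\<lambda>p. f p ^ n) \<in> pair_polys"
  by (induction n) (auto intro: pair_polys.intros)

lemma pair_polys_sum: "(\<And>i. i \<in> I \<Longrightarrow> f i \<in> pair_polys) \<Longrightarrow> (\<lambda>p. \<Sum>i\<in>I. f i p) \<in> pair_polys"
  by (induction I rule: infinite_finite_induct) (auto intro: pair_polys.intros)

lemma poly_mat_mult: "poly_mat F \<Longrightarrow> poly_mat G \<Longrightarrow> poly_mat (\<lambda>p. F p ** G p)"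
  unfolding poly_mat_def matrix_matrix_mult_def by (auto intro!: pair_polys_sum pair_polys.mult)

lemma poly_mat_diff: "poly_mat F \<Longrightarrow> poly_mat G \<Longrightarrow> poly_mat (\<lambda>p. F p - G p)"
  unfolding poly_mat_def by (auto intro!: pair_polys_diff)

lemma pair_polys_trace: "poly_mat F \<Longrightarrow> (\<lambda>p. trace (F p)) \<in> pair_polys"
  unfolding poly_mat_def trace_def by (auto intro!: pair_polys_sum)

lemma poly_mat_proj: "poly_mat fst" "poly_mat snd"
  unfolding poly_mat_def by (auto intro: pair_polys.intros)

lemma pair_polys_det: "(\<lambda>p. det (fst p)) \<in> pair_polys"
  unfolding det_3 by (intro pair_polys_diff pair_polys.intros)

lemma pair_polys_minors2: "(\<lambda>p. minors2 (fst p)) \<in> pair_polys"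
proof -
  have "(\<lambda>p. ((trace (fst p))\<^sup>2 - trace (fst p ** fst p)) * (1 / 2)) \<in> pair_polys"
    by (intro pair_polys.mult pair_polys.const pair_polys_diff pair_polys_power pair_polys_trace
        poly_mat_mult poly_mat_proj)
  then show ?thesis by (simp add: minors2_def)
qed

lemma pair_polys_char_disc: "(\<lambda>p. char_disc (fst p)) \<in> pair_polys"
  unfolding char_disc_def disc_def
  by (intro pair_polys_diff pair_polys_power pair_polys.mult pair_polys.const pair_polys.add
      pair_polys_trace poly_mat_proj pair_polys_det pair_polys_minors2)

lemma pair_polys_gram: "(\<lambda>p. gram (fst p) (snd p)) \<in> pair_polys"
  unfolding gram_def Let_def comm_def
  by (intro pair_polys_diff pair_polys_power pair_polys.mult pair_polys.const pair_polys.add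
      pair_polys_trace poly_mat_proj poly_mat_mult poly_mat_diff)

section \<open>The set of pairs in general position\<close>

definition general_pairs :: "(mat3 \<times> mat3) set" where
  "general_pairs = {p \<in> GL3 \<times> GL3. char_disc (fst p) * gram (fst p) (snd p) \<noteq> 0}"

lemma zariski_open_general_pairs: "zariski_open general_pairs"
  unfolding zariski_open_def general_pairs_def
  by (intro exI[of _ "{\<lambda>p. char_disc (fst p) * gram (fst p) (snd p)}"])
    (auto intro: pair_polys.mult pair_polys_char_disc pair_polys_gram)

lemma general_pairs_nonempty: "general_pairs \<noteq> {}"
proof -
  define h :: "complex^3" where "h = vector [1, 2, 3]"
  \<comment> \<open>The identity plus the singular all-ones matrix: no off-diagonal entry vanishes,
    and the determinant is 4.\<close>
  define U :: mat3 where "U = (\<chi> i j. if i = j then 2 else 1)"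
  have "char_disc (diag h) \<noteq> 0" "gram (diag h) U \<noteq> 0"
    unfolding char_disc_diag gram_diag by (simp_all add: h_def U_def)
  moreover have "det (diag h) \<noteq> 0" "det U \<noteq> 0"
    by (simp_all add: det_3 diag_def h_def U_def)
  ultimately have "(diag h, U) \<in> general_pairs"
    by (simp add: general_pairs_def GL3_def invertible_det_nz)
  then show ?thesis by blast
qed

lemma intertwines_conj:
  assumes "invertible g"
  shows "intertwines g (g ** A ** matrix_inv g) A"
  using assms by (simp add: intertwines_def matrix_inv_left flip: matrix_mul_assoc)

lemma conj_invariant_general_pairs: "conj_invariant general_pairs"
  unfolding conj_invariant_def
proof (intro allI impI)
  fix p q assume p: "p \<in> general_pairs" and "sim_conj p q"
  then obtain g where g: "invertible g" "fst q = g ** fst p ** matrix_inv g" "snd q = g ** snd p ** matrix_inv g"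
    by (auto simp: sim_conj_def)
  then have i: "intertwines g (fst q) (fst p)" "intertwines g (snd q) (snd p)"
    by (simp_all add: intertwines_conj)
  note e = det_intertwines[OF g(1) i(1)] det_intertwines[OF g(1) i(2)]
    char_disc_intertwines[OF g(1) i(1)] gram_intertwines[OF g(1) i]
  from p e show "q \<in> general_pairs"
    by (simp add: general_pairs_def GL3_def invertible_det_nz mem_Times_iff)
qed

text \<open>By \<open>gram_diag\<close>, the invariant \<open>gram A B\<close> has
  \<open>h_2 - h_3\<close>, \<open>u_12\<close> and \<open>u_13\<close> among its factors, whichever
  ordering \<open>h\<close> is chosen.\<close>

lemma dist_defined_general_pairs:
  assumes "(A, B) \<in> general_pairs" "eigenbasis A h P"
  shows "dist_defined h (in_basis P B)"
proof -
  have "invertible P" "intertwines P A (diag h)"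
    using assms(2) by (simp_all add: eigenbasis_iff)
  then have "gram A B = gram (diag h) (in_basis P B)"
    by (intro gram_intertwines[of P]) (simp_all add: intertwines_in_basis)
  moreover have "gram A B \<noteq> 0" using assms(1) by (simp add: general_pairs_def)
  ultimately show ?thesis by (auto simp: gram_diag dist_defined_def)
qed

text \<open>Pairs with the same matrices in the bases \<open>P\<close> and \<open>P'\<close> are
  conjugate by the map taking the one basis to the other.\<close>

lemma sim_conjI:
  assumes P: "invertible P" "intertwines P A X" "intertwines P B Y"
    and P': "invertible P'" "intertwines P' A' X" "intertwines P' B' Y"
  shows "sim_conj (A, B) (A', B')"
proof -
  define g where "g = P' ** matrix_inv P"
  have "invertible (matrix_inv P)"
    using P(1) matrix_inv_left matrix_inv_right by (auto simp: invertible_def)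
  then have g: "invertible g" unfolding g_def using P'(1) by (rule invertible_mult[rotated])
  have gP: "g ** P = P'" by (simp add: g_def matrix_inv_left[OF P(1)] flip: matrix_mul_assoc)
  have conj: "Z' = g ** Z ** matrix_inv g" if "intertwines P Z W" "intertwines P' Z' W" for Z Z' W
  proof -
    have "Z' ** g ** P = g ** Z ** P"
      using that gP unfolding intertwines_def by (metis matrix_mul_assoc)
    then have "Z' ** g = g ** Z"
      by (metis P(1) matrix_inv_right matrix_mul_assoc matrix_mul_rid)
    then show ?thesis
      by (metis g matrix_inv_right matrix_mul_assoc matrix_mul_rid)
  qed
  show ?thesis
    unfolding sim_conj_def using g conj[OF P(2) P'(2)] conj[OF P(3) P'(3)] by auto
qed

theorem theorem2p1:
  shows "\<exists>\<Omega> :: (mat3 \<times> mat3) set.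
    \<Omega> \<noteq> {} \<and> \<Omega> \<subseteq> GL3 \<times> GL3 \<and> zariski_open \<Omega> \<and> conj_invariant \<Omega> \<and>
    (\<forall>A B. (A, B) \<in> \<Omega> \<longrightarrow>
       card (eigenvalues A) = 3 \<and>
       (\<forall>h. eigenvalue_ordering A h \<longrightarrow>
          (\<exists>P. eigenbasis A h P) \<and>
          (\<forall>P. eigenbasis A h P \<longrightarrow> dist_defined h (in_basis P B)) \<and>
          (\<forall>A' B' P P'. sim_conj (A, B) (A', B') \<longrightarrow>
             eigenbasis A h P \<longrightarrow> eigenbasis A' h P' \<longrightarrow>
             dist_point h (in_basis P B) = dist_point h (in_basis P' B')))) \<and>
    (\<forall>A B A' B' h P P'.
       (A, B) \<in> \<Omega> \<longrightarrow> (A', B') \<in> \<Omega> \<longrightarrow>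
       spectral_form A B = spectral_form A' B' \<longrightarrow>
       eigenvalue_ordering A h \<longrightarrow> eigenvalue_ordering A' h \<longrightarrow>
       eigenbasis A h P \<longrightarrow> eigenbasis A' h P' \<longrightarrow>
       dist_point h (in_basis P B) = dist_point h (in_basis P' B') \<longrightarrow>
       sim_conj (A, B) (A', B'))"
proof (intro exI[of _ general_pairs] conjI allI impI general_pairs_nonempty
    zariski_open_general_pairs conj_invariant_general_pairs)
  show "general_pairs \<subseteq> GL3 \<times> GL3" by (auto simp: general_pairs_def)
next
  fix A B assume "(A, B) \<in> general_pairs"
  then show "card (eigenvalues A) = 3"
    by (intro card_eigenvalues) (simp add: general_pairs_def)
next
  fix A h assume "eigenvalue_ordering A h"
  then show "\<exists>P. eigenbasis A h P" by (rule eigenbasis_exists)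
next
  fix A B h P assume "(A, B) \<in> general_pairs" "eigenbasis A h P"
  then show "dist_defined h (in_basis P B)" by (rule dist_defined_general_pairs)
next
  fix A B h A' B' P P'
  assume AB: "(A, B) \<in> general_pairs" and o: "eigenvalue_ordering A h"
    and c: "sim_conj (A, B) (A', B')" and P: "eigenbasis A h P" and P': "eigenbasis A' h P'"
  have h: "inj (\<lambda>i. h$i)" using o by (simp add: eigenvalue_ordering_def bij_betw_def)
  have AB': "(A', B') \<in> general_pairs"
    using conj_invariant_general_pairs AB c unfolding conj_invariant_def by blast
  obtain g where g: "invertible g" "A' = g ** A ** matrix_inv g" "B' = g ** B ** matrix_inv g"
    using c by (auto simp: sim_conj_def)
  note i = intertwines_conj[OF g(1), folded g(2)] intertwines_conj[OF g(1), folded g(3)]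
  \<comment> \<open>The transported eigenbasis \<open>g ** P\<close> gives \<open>B'\<close> the
    matrix that \<open>P\<close> gives \<open>B\<close>, so only a change of eigenbasis of
    \<open>A'\<close> is left.\<close>
  have gP: "invertible (g ** P)" using g(1) P by (simp add: eigenbasis_iff invertible_mult)
  have comp: "intertwines (g ** P) X' Y" if "intertwines g X' X" "intertwines P X Y" for X X' Y
    using that unfolding intertwines_def by (metis matrix_mul_assoc)
  have e: "eigenbasis A' h (g ** P)"
    using gP comp[OF i(1)[of A]] P g by (simp add: eigenbasis_iff)
  have b: "in_basis (g ** P) B' = in_basis P B"
    using intertwines_unique[OF gP] comp i(2)[of B] intertwines_in_basis P g(3) by (metis eigenbasis_iff)
  obtain q where "\<And>i. q i \<noteq> 0"
    "\<And>i j. q i * in_basis P' B' $ i $ j = in_basis P B $ i $ j * q j"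
    using in_basis_rescale[OF e P' h, of B'] unfolding b by blast
  then show "dist_point h (in_basis P B) = dist_point h (in_basis P' B')"
    by (rule dist_point_rescale[OF dist_defined_general_pairs[OF AB P] dist_defined_general_pairs[OF AB' P']])
next
  fix A B A' B' h P P'
  assume AB: "(A, B) \<in> general_pairs" and AB': "(A', B') \<in> general_pairs"
    and s: "spectral_form A B = spectral_form A' B'"
    and o: "eigenvalue_ordering A h"
    and P: "eigenbasis A h P" and P': "eigenbasis A' h P'"
    and d: "dist_point h (in_basis P B) = dist_point h (in_basis P' B')"
  have h: "inj (\<lambda>i. h$i)" using o by (simp add: eigenvalue_ordering_def bij_betw_def)
  have iP: "invertible P" "intertwines P A (diag h)" "intertwines P B (in_basis P B)"
    and iP': "invertible P'" "intertwines P' A' (diag h)" "intertwines P' B' (in_basis P' B')"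
    using P P' by (simp_all add: eigenbasis_iff intertwines_in_basis)
  obtain q where q: "\<And>i. q i \<noteq> 0"
    "\<And>i j. q i * in_basis P' B' $ i $ j = in_basis P B $ i $ j * q j"
    using reconstruction[OF _ h dist_defined_general_pairs[OF AB P] dist_defined_general_pairs[OF AB' P'] d]
      s spectral_form_intertwines[OF iP] spectral_form_intertwines[OF iP'] by auto
  \<comment> \<open>Since \<open>Q\<close> commutes with \<open>diag h\<close>, the rescaled
    \<open>P ** Q\<close> is still an eigenbasis of \<open>A\<close>, and in it \<open>B\<close> has
    the matrix that \<open>B'\<close> has in \<open>P'\<close>.\<close>
  define Q where "Q = diag (\<chi> i. q i)"
  have Q: "invertible Q"
    using q(1) by (simp add: Q_def invertible_det_nz det_3 diag_def)
  have "diag h ** Q = Q ** diag h" "in_basis P B ** Q = Q ** in_basis P' B'"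
    using q(2) by (simp_all add: Q_def vec_eq_iff diag_mult mult_diag)
    (simp add: diag_def)
  then have "intertwines (P ** Q) A (diag h)" "intertwines (P ** Q) B (in_basis P' B')"
    using iP(2,3) unfolding intertwines_def by (metis matrix_mul_assoc)+
  then show "sim_conj (A, B) (A', B')"
    using sim_conjI iP' invertible_mult[OF iP(1) Q] by blast
qed

end
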